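(* Let $n_1,n_2$ be distinct odd primes with $\gcd(n_1-1,n_2-1)=6$, $n=n_1n_2$, $e=(n_1-1)(n_2-1)/6$. Let $g$ be a common primitive root of $n_1$ and $n_2$, let $u$ be an integer with $u\equiv g \pmod{n_1}$ and $u\equiv 1\pmod{n_2}$, and for $i=0,\dots,5$ let $D_i=\{g^s u^i \bmod n : s=0,1,\dots,e-1\}$. Let $q$ be a power of a prime $p$ with $\gcd(q,n)=1$, and suppose $q\bmod n\in D_0\cup D_2\cup D_4$. Let $\boldsymbol{C_s}$ be the cyclic code over $\mathrm{GF}(q)$ defined by the Whiteman generalized cyclotomic sequence of order 6 (see context), with generator polynomial $g_s(x)=\frac{x^n-1}{\gcd(x^n-1,S(x))}$. Assign indices as follows: if $S(\beta)=0$ the index $0$, if $S(\beta)=-1$ the index $3$; if $T(\beta)=0$ the index $1$, if $T(\beta)=-1$ the index $4$; if $M(\beta)=0$ the index $2$, if $M(\beta)=-1$ the index $5$. Suppose that at least one of $S(\beta),T(\beta),M(\beta)$ lies in $\{0,-1\}$, let $K$ be the set of indices assigned to those of $S(\beta),T(\beta),M(\beta)$ lying in $\{0,-1\}$ (so $|K|\in\{1,2,3\}$ is exactly the number of them lying in $\{0,-1\}$), and put $P(x)=\prod_{k\in K}d_k(x)$. Then $$g_s(x)=\begin{cases} \frac{x^n-1}{P(x)}, & \Omega_1\neq 0,\ \Omega_2\neq 0,\ \Omega\neq 0,\\ \frac{x^n-1}{(x-1)P(x)}, & \Omega_1\neq 0,\ \Omega_2\neq 0,\ \Omega=0,\\ \frac{x^n-1}{(x^{n_2}-1)P(x)},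 & \Omega_1=0,\ \Omega_2\neq 0,\ \Omega=0,\\ \frac{x^n-1}{(x^{n_1}-1)P(x)}, & \Omega_1\neq 0,\ \Omega_2=0,\ \Omega=0,\\ \frac{d(x)}{P(x)}, & \Omega_1=\Omega_2=\Omega=0.\end{cases}$$
   Context: The sets $D_0,\dots,D_5$ partition $\mathbb{Z}_n^*$. Let $m$ be the multiplicative order of $q$ modulo $n$, $\alpha$ a primitive element of $\mathrm{GF}(q^m)$ and $\beta=\alpha^{(q^m-1)/n}$, a primitive $n$-th root of unity. Let $N_1=\{n_1,2n_1,\dots,(n_2-1)n_1\}$, $N_2=\{n_2,2n_2,\dots,(n_1-1)n_2\}$. Define in $\mathrm{GF}(q)[x]$: $S(x)=\sum_{i\in N_1\cup D_0\cup D_1\cup D_2}x^i$, $T(x)=\sum_{i\in N_1\cup D_1\cup D_2\cup D_3}x^i$, $M(x)=\sum_{i\in N_1\cup D_2\cup D_3\cup D_4}x^i$. The sequence $(s_i)_{i=0}^{n-1}$ has $s_i=1$ if $i\in N_1\cup D_0\cup D_1\cup D_2$ and $s_i=0$ otherwise, so its generator polynomial is $S(x)$; $\boldsymbol{C_s}$ is the cyclic code of length $n$ over $\mathrm{GF}(q)$ generated by $\frac{x^n-1}{\gcd(x^n-1,S(x))}$. Let $\Omega_1=\frac{n_1+1}{2}\bmod p$, $\Omega_2=\frac{n_2-1}{2}\bmod p$, $\Omega=\frac{(n_1+1)(n_2-1)}{2}\bmod p$ (images in $\mathrm{GF}(p)\subseteq\mathrm{GF}(q)$), $d(x)=\prod_{i\in\mathbb{Z}_n^*}(x-\beta^i)$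 and $d_a(x)=\prod_{i\in D_a}(x-\beta^i)$ for $a=0,\dots,5$. *)

theory Defs
  imports "HOL-Library.Cardinality" "HOL-Computational_Algebra.Computational_Algebra" "HOL-Number_Theory.Residue_Primitive_Roots"
begin

definition units_mod :: "nat \<Rightarrow> nat set" where
  "units_mod n = {i. i < n \<and> coprime i n}"

definition whiteman_class :: "nat \<Rightarrow> nat \<Rightarrow> nat \<Rightarrow> int \<Rightarrow> nat \<Rightarrow> nat set" where
  "whiteman_class n e g u i = {nat ((int g ^ s * u ^ i) mod int n) | s. s < e}"

definition N1_set :: "nat \<Rightarrow> nat \<Rightarrow> nat set" where
  "N1_set n1 n2 = {k * n1 | k. 1 \<le> k \<and> k \<le> n2 - 1}"

definition set_poly :: "nat set \<Rightarrow> 'a::comm_ring_1 poly" where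
  "set_poly A = (\<Sum>i\<in>A. Polynomial.monom 1 i)"

definition root_prod :: "'b::comm_ring_1 \<Rightarrow> nat set \<Rightarrow> 'b poly" where
  "root_prod b A = (\<Prod>i\<in>A. [:- (b ^ i), 1:])"

definition xpow_minus1 :: "nat \<Rightarrow> 'a::comm_ring_1 poly" where
  "xpow_minus1 k = Polynomial.monom 1 k - 1"

definition primitive_elem :: "'b::field \<Rightarrow> bool" where
  "primitive_elem a \<longleftrightarrow> (\<forall>x. x \<noteq> 0 \<longrightarrow> (\<exists>k. a ^ k = x))"

end

theory Submission
  imports Defs
begin

text \<open>
  Over the extension field \<open>x ^ n - 1\<close> is the product of the distinct factors \<open>x - \<beta> ^ t\<close> for
  \<open>t < n\<close>, so \<open>g\<^sub>s\<close> is the product of those with \<open>S(\<beta> ^ t) \<noteq> 0\<close>. At \<open>t = 0\<close>, at the nonzero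
  multiples of \<open>n1\<close> and at those of \<open>n2\<close> the value \<open>S(\<beta> ^ t)\<close> is \<open>\<Omega>\<close>, \<open>-\<Omega>1\<close> and \<open>\<Omega>2\<close>. For \<open>t\<close> in
  \<open>D\<^sub>j\<close> it is \<open>W\<^sub>j = -1 + \<eta>\<^sub>j + \<eta>\<^sub>j\<^sub>+\<^sub>1 + \<eta>\<^sub>j\<^sub>+\<^sub>2\<close> with the Gauss periods \<open>\<eta>\<^sub>a\<close> of the classes \<open>D\<^sub>a\<close>, indexed
  modulo 6. Here \<open>W\<^sub>0, W\<^sub>1, W\<^sub>2\<close> are \<open>S(\<beta>), T(\<beta>), M(\<beta>)\<close>, and \<open>W\<^sub>j + W\<^sub>j\<^sub>+\<^sub>3 = -1\<close> because all six periods
  add up to 1; hence \<open>K\<close> is exactly the set of \<open>j\<close> with \<open>W\<^sub>j = 0\<close>.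
\<close>

section \<open>Roots of unity and power sums\<close>

lemma sum_periodic_shift:
  fixes f :: "nat \<Rightarrow> 'c::ab_group_add"
  assumes "\<And>i. f (i + N) = f i"
  shows "(\<Sum>i<N. f (i + s)) = (\<Sum>i<N. f i)"
proof (induction s)
  case (Suc s)
  have "(\<Sum>i<N. f (Suc i + s)) + f s = (\<Sum>i<Suc N. f (i + s))"
    by (subst sum.lessThan_Suc_shift) (simp add: add.commute)
  also have "\<dots> = (\<Sum>i<N. f (i + s)) + f s"
    using assms[of s] by (simp add: add.commute)
  finally show ?case
    using Suc by simp
qed simp

lemma sum_periodic_blocks:
  fixes f :: "nat \<Rightarrow> 'c::comm_ring_1"
  assumes "\<And>i. f (i + N) = f i"
  shows "(\<Sum>i<c * N. f i) = of_nat c * (\<Sum>i<N. f i)"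
proof (induction c)
  case (Suc c)
  have per: "f (i + c * N) = f i" for i
  proof (induction c)
    case (Suc c)
    then show ?case
      using assms[of "i + c * N"] by (simp add: ac_simps)
  qed simp
  have "{..<Suc c * N} = {..<c * N} \<union> {c * N..<c * N + N}"
    by auto
  then have "(\<Sum>i<Suc c * N. f i) = (\<Sum>i<c * N. f i) + sum f {c * N..<c * N + N}"
    by (simp add: sum.union_disjoint ivl_disj_int)
  also have "sum f {c * N..<c * N + N} = (\<Sum>i<N. f (i + c * N))"
    using sum.shift_bounds_nat_ivl[of f 0 "c * N" N]
    by (simp add: atLeast0LessThan add.commute)
  finally show ?case
    using Suc per by (simp add: algebra_simps)
qed simp

lemma root_of_unity_power_cong:
  fixes r :: "'c::monoid_mult"
  assumes "r ^ N = 1" "[x = y] (mod N)"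
  shows "r ^ x = r ^ y"
proof -
  have "r ^ z = r ^ (z mod N)" for z
  proof -
    have "r ^ z = r ^ (N * (z div N) + z mod N)" by simp
    also have "\<dots> = r ^ (z mod N)"
      unfolding power_add power_mult assms(1) by simp
    finally show ?thesis .
  qed
  then show ?thesis
    using assms(2) by (metis cong_def)
qed

lemma sum_powers_root_of_unity:
  fixes r :: "'c::field"
  assumes "r ^ N = 1" "r \<noteq> 1"
  shows "(\<Sum>i<N. r ^ i) = 0"
  using assms by (simp add: geometric_sum)

lemma sum_nontrivial_powers_root_of_unity:
  fixes r :: "'c::field"
  assumes "N > 0" "r ^ N = 1" "r \<noteq> 1"
  shows "(\<Sum>i\<in>{0<..<N}. r ^ i) = -1"
proof -
  have "{..<N} = insert 0 {0<..<N}"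
    using assms(1) by auto
  then have "(\<Sum>i<N. r ^ i) = 1 + (\<Sum>i\<in>{0<..<N}. r ^ i)" by simp
  then show ?thesis
    using sum_powers_root_of_unity[OF assms(2,3)] by (simp add: eq_neg_iff_add_eq_0 add.commute)
qed

lemma residue_primroot_prime:
  assumes "prime p" "residue_primroot p g"
  shows "coprime p g" "ord p g = p - 1"
  using assms by (auto simp: residue_primroot_def totient_prime)

text \<open>Modulo \<open>p\<close> the powers of \<open>g\<close> run once through the nonzero
  residues in each period of length \<open>p - 1\<close>, wherever the period starts. So each of the
  \<open>c\<close> periods contributes the sum of the nontrivial powers of \<open>r\<close>, which
  is -1.\<close>

lemma sum_primroot_powers:
  fixes r :: "'c::field"
  assumes p: "prime p" "residue_primroot p g" and r: "r ^ p = 1" "r \<noteq> 1"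
  shows "(\<Sum>s<c * (p - 1). r ^ (g ^ (s + a))) = - of_nat c"
proof -
  note g = residue_primroot_prime[OF p]
  have per: "r ^ (g ^ (s + (p - 1))) = r ^ (g ^ s)" for s
  proof (rule root_of_unity_power_cong[OF r(1)])
    show "[g ^ (s + (p - 1)) = g ^ s] (mod p)"
      unfolding order_divides_expdiff[OF g(1)] g(2) by (simp only: cong_def mod_add_self2)
  qed
  have per': "r ^ (g ^ (s + (p - 1) + a)) = r ^ (g ^ (s + a))" for s
    using per[of "s + a"] by (simp add: ac_simps)
  have bij: "bij_betw (\<lambda>i. g ^ i mod p) {..<p - 1} {0<..<p}"
    using residue_primroot_is_generator[OF prime_gt_1_nat[OF p(1)] p(2)] p(1)
    by (simp add: totient_prime totatives_prime)
  have "(\<Sum>s<p - 1. r ^ (g ^ s)) = (\<Sum>s<p - 1. r ^ (g ^ s mod p))"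
    by (intro sum.cong refl root_of_unity_power_cong[OF r(1)]) (simp add: cong_def)
  also have "\<dots> = (\<Sum>i\<in>{0<..<p}. r ^ i)"
    by (rule sum.reindex_bij_betw[OF bij])
  also have "\<dots> = -1"
    by (rule sum_nontrivial_powers_root_of_unity[OF prime_gt_0_nat[OF p(1)] r])
  finally have *: "(\<Sum>s<p - 1. r ^ (g ^ s)) = -1" .
  have "(\<Sum>s<c * (p - 1). r ^ (g ^ (s + a))) = of_nat c * (\<Sum>s<p - 1. r ^ (g ^ (s + a)))"
    by (rule sum_periodic_blocks) (rule per')
  also have "(\<Sum>s<p - 1. r ^ (g ^ (s + a))) = (\<Sum>s<p - 1. r ^ (g ^ s))"
    by (rule sum_periodic_shift) (rule per)
  finally show ?thesis
    using * by simp
qed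

section \<open>Whiteman classes\<close>

text \<open>\<open>v\<close> stands for the residue of the integer \<open>u\<close> modulo
  \<open>n\<close>; being a natural number, it can occur in exponents.\<close>

locale whiteman =
  fixes n1 n2 n e g v :: nat
  assumes prime1: "prime n1" and prime2: "prime n2" and distinct: "n1 \<noteq> n2"
    and gcd6: "gcd (n1 - 1) (n2 - 1) = 6"
    and n_def: "n = n1 * n2" and e_def: "e = (n1 - 1) * (n2 - 1) div 6"
    and prim1: "residue_primroot n1 g" and prim2: "residue_primroot n2 g"
    and v1: "[v = g] (mod n1)" and v2: "[v = 1] (mod n2)"
begin

text \<open>The index \<open>a\<close> is not reduced modulo 6, so shifted indices such as
  \<open>a + c\<close> make sense directly.\<close>

definition cyc :: "nat \<Rightarrow> nat set" where
  "cyc a = (\<lambda>s. g ^ s * v ^ a mod n) ` {..<e}"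

definition N1 :: "nat set" where
  "N1 = (\<lambda>k. k * n1) ` {0<..<n2}"

definition N2 :: "nat set" where
  "N2 = (\<lambda>k. k * n2) ` {0<..<n1}"

lemma coprime12: "coprime n1 n2"
  using prime1 prime2 distinct by (simp add: primes_coprime)

lemma gt_1: "n1 > 1" "n2 > 1"
  using prime_gt_1_nat[OF prime1] prime_gt_1_nat[OF prime2] .

lemma n_pos: "n > 0"
  using gt_1 by (simp add: n_def)

lemma six_dvd: "6 dvd n1 - 1" "6 dvd n2 - 1"
  using gcd6 by (metis gcd_dvd1, metis gcd_dvd2)

lemma six_e: "6 * e = (n1 - 1) * (n2 - 1)"
  unfolding e_def using six_dvd(1) by (intro dvd_mult_div_cancel dvd_mult2)

text \<open>Cuts a range of length \<open>e\<close> into full periods of length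
  \<open>n2 - 1\<close>, the form that \<open>sum_primroot_powers\<close> expects.\<close>

lemma e_blocks1: "e = (n1 - 1) div 6 * (n2 - 1)"
  unfolding e_def using six_dvd(1) by (simp only: dvd_div_mult)

lemma e_blocks2: "e = (n2 - 1) div 6 * (n1 - 1)"
  unfolding e_def mult.commute[of "n1 - 1"] using six_dvd(2) by (simp only: dvd_div_mult)

text \<open>The gcd is 6 and its product with the lcm is \<open>6 * e\<close>. Hence exponents that
  agree modulo both \<open>n1 - 1\<close> and \<open>n2 - 1\<close> agree modulo
  \<open>e\<close>.\<close>

lemma lcm_eq_e: "lcm (n1 - 1) (n2 - 1) = e"
  using prod_gcd_lcm_nat[of "n1 - 1" "n2 - 1"] unfolding gcd6 six_e[symmetric] by simp

lemma cong_n_iff: "[x = y] (mod n) \<longleftrightarrow> [x = y] (mod n1) \<and> [x = y] (mod n2)" for x y :: nat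
  unfolding n_def using coprime12
  by (metis coprime_cong_mult_nat cong_dvd_modulus_nat dvd_triv_left dvd_triv_right)

section \<open>Discrete logarithms of the products \<open>g ^ s * v ^ a\<close>\<close>

lemma generator_cong1: "[g ^ s * v ^ a = g ^ (s + a)] (mod n1)"
  using cong_mult[OF cong_refl cong_pow[OF v1]] by (simp add: power_add)

lemma generator_cong2: "[g ^ s * v ^ a = g ^ s] (mod n2)"
  using cong_mult[OF cong_refl cong_pow[OF v2], of "g ^ s" a] by simp

lemma power_cong_iff1: "[g ^ s = g ^ t] (mod n1) \<longleftrightarrow> [s = t] (mod (n1 - 1))"
  using residue_primroot_prime[OF prime1 prim1] order_divides_expdiff by metis

lemma power_cong_iff2: "[g ^ s = g ^ t] (mod n2) \<longleftrightarrow> [s = t] (mod (n2 - 1))"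
  using residue_primroot_prime[OF prime2 prim2] order_divides_expdiff by metis

text \<open>As \<open>v\<close> acts like \<open>g\<close> modulo \<open>n1\<close> and like 1
  modulo \<open>n2\<close>, the discrete logarithms to base \<open>g\<close> are
  \<open>s + a\<close> and \<open>s\<close>. The two conditions combine because \<open>n1\<close>
  and \<open>n2\<close> are coprime.\<close>

lemma generator_cong_iff:
  "[g ^ s * v ^ a = g ^ t * v ^ b] (mod n) \<longleftrightarrow>
     [s + a = t + b] (mod (n1 - 1)) \<and> [s = t] (mod (n2 - 1))"
proof -
  have "[g ^ s * v ^ a = g ^ t * v ^ b] (mod n1) \<longleftrightarrow> [g ^ (s + a) = g ^ (t + b)] (mod n1)"
    using generator_cong1 by (meson cong_sym cong_trans)
  moreover have "[g ^ s * v ^ a = g ^ t * v ^ b] (mod n2) \<longleftrightarrow> [g ^ s = g ^ t] (mod n2)"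
    using generator_cong2 by (meson cong_sym cong_trans)
  ultimately show ?thesis
    by (simp add: cong_n_iff power_cong_iff1 power_cong_iff2)
qed

text \<open>Both moduli are divisible by 6. Reduction modulo 6 cancels \<open>s\<close> against
  \<open>t\<close> and forces \<open>a = b\<close>; after that \<open>s\<close> and \<open>t\<close>
  agree modulo the lcm \<open>e\<close>.\<close>

lemma generator_inj:
  assumes "[g ^ s * v ^ a = g ^ t * v ^ b] (mod n)" "s < e" "t < e" "a < 6" "b < 6"
  shows "s = t \<and> a = b"
proof -
  have 1: "[s + a = t + b] (mod (n1 - 1))" and 2: "[s = t] (mod (n2 - 1))"
    using assms(1) by (simp_all add: generator_cong_iff)
  have "[s + a = t + b] (mod 6)" "[s = t] (mod 6)"
    using cong_dvd_modulus_nat[OF 1 six_dvd(1)] cong_dvd_modulus_nat[OF 2 six_dvd(2)] .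
  then have "[s + a = s + b] (mod 6)"
    by (meson cong_add_rcancel_nat cong_sym cong_trans)
  then have "[a = b] (mod 6)"
    by (simp add: cong_add_lcancel_nat)
  then have ab: "a = b"
    using assms by (simp add: cong_def)
  then have "[s = t] (mod (n1 - 1))"
    using 1 by (simp add: cong_add_rcancel_nat)
  then have "[s = t] (mod lcm (n1 - 1) (n2 - 1))"
    using 2 by (rule cong_cong_lcm_nat)
  then show ?thesis
    using assms ab unfolding lcm_eq_e by (simp add: cong_def)
qed

lemma coprime_n_g: "coprime n g"
  unfolding n_def using residue_primroot_prime(1)[OF prime1 prim1]
    residue_primroot_prime(1)[OF prime2 prim2] by simp

lemma coprime_n_v: "coprime n v"
proof -
  have "coprime n1 v"
    using cong_imp_coprime[OF cong_sym[OF v1]] residue_primroot_prime(1)[OF prime1 prim1]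
    by (simp add: coprime_commute)
  moreover have "coprime n2 v"
    using cong_imp_coprime[OF cong_sym[OF v2]] by (simp add: coprime_commute)
  ultimately show ?thesis
    by (simp add: n_def)
qed

lemma card_units: "card (units_mod n) = 6 * e"
proof -
  have n: "n > 1"
    unfolding n_def using gt_1 by (rule less_1_mult)
  have "units_mod n = totatives n"
  proof (intro equalityI subsetI)
    fix t assume "t \<in> units_mod n"
    then show "t \<in> totatives n"
      using n by (cases "t = 0") (auto simp: units_mod_def totatives_def)
  next
    fix t assume "t \<in> totatives n"
    then show "t \<in> units_mod n"
      using totatives_less[OF _ n] by (auto simp: units_mod_def totatives_def)
  qed
  then have "card (units_mod n) = totient n"
    by (simp add: totient_def)
  then show ?thesis
    by (simp add: n_def totient_mult_coprime coprime12 totient_prime prime1 prime2 six_e)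
qed

lemma finite_units: "finite (units_mod n)"
  by (simp add: units_mod_def)

text \<open>Both sides have \<open>6 * e\<close> elements, so injectivity gives
  surjectivity.\<close>

lemma bij_generators:
  "bij_betw (\<lambda>(a, s). g ^ s * v ^ a mod n) ({..<6} \<times> {..<e}) (units_mod n)"
proof -
  let ?f = "\<lambda>(a, s). g ^ s * v ^ a mod n"
  have inj: "inj_on ?f ({..<6} \<times> {..<e})"
  proof (rule inj_onI, clarsimp)
    fix a s b t
    assume "a < 6" "s < e" "b < 6" "t < e"
      and "g ^ s * v ^ a mod n = g ^ t * v ^ b mod n"
    then show "a = b \<and> (s::nat) = t"
      using generator_inj[of s a t b] by (simp add: cong_def)
  qed
  moreover have "?f ` ({..<6} \<times> {..<e}) \<subseteq> units_mod n"
    using n_pos coprime_n_g coprime_n_v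
    by (auto simp: units_mod_def coprime_commute)
  ultimately show ?thesis
    using card_subset_eq[OF finite_units, of "?f ` ({..<6} \<times> {..<e})"]
    by (auto simp: bij_betw_def card_image card_units)
qed

section \<open>Partition of the residues modulo \<open>n\<close> into classes and nonunits\<close>

lemma finite_cyc [simp]: "finite (cyc a)"
  by (simp add: cyc_def)

lemma units_eq_UN_cyc: "units_mod n = (\<Union>a<6. cyc a)"
proof -
  have "units_mod n = (\<lambda>(a, s). g ^ s * v ^ a mod n) ` ({..<6} \<times> {..<e})"
    using bij_generators by (simp add: bij_betw_def)
  then show ?thesis
    by (auto simp: cyc_def)
qed

lemma cyc_disjoint:
  assumes "a < 6" "b < 6" "a \<noteq> b"
  shows "cyc a \<inter> cyc b = {}"
proof -
  have False if t: "t \<in> cyc a" "t \<in> cyc b" for t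
  proof -
    obtain x where x: "x < e" "t = g ^ x * v ^ a mod n"
      using t(1) unfolding cyc_def by blast
    obtain y where y: "y < e" "t = g ^ y * v ^ b mod n"
      using t(2) unfolding cyc_def by blast
    have "[g ^ x * v ^ a = g ^ y * v ^ b] (mod n)"
      using x(2) y(2) by (simp only: cong_def)
    from generator_inj[OF this x(1) y(1) assms(1,2)] assms(3) show False
      by simp
  qed
  then show ?thesis by blast
qed

text \<open>With the same \<open>a\<close> on both sides it cancels without any bound on it, so the
  result also covers shifted indices from 6 on.\<close>

lemma inj_on_cyc: "inj_on (\<lambda>s. g ^ s * v ^ a mod n) {..<e}"
proof (rule inj_onI)
  fix s t assume "s \<in> {..<e}" "t \<in> {..<e}" and eq: "g ^ s * v ^ a mod n = g ^ t * v ^ a mod n"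
  then have "[s + a = t + a] (mod (n1 - 1)) \<and> [s = t] (mod (n2 - 1))"
    unfolding generator_cong_iff[symmetric] by (simp only: cong_def)
  then have "[s = t] (mod lcm (n1 - 1) (n2 - 1))"
    unfolding cong_add_rcancel_nat by (blast intro: cong_cong_lcm_nat)
  then have "[s = t] (mod e)"
    unfolding lcm_eq_e .
  with \<open>s \<in> {..<e}\<close> \<open>t \<in> {..<e}\<close> show "s = t"
    by (simp add: cong_def)
qed

lemma card_cyc: "card (cyc a) = e"
  unfolding cyc_def by (simp add: card_image inj_on_cyc)

lemma cyc_coprime: "t \<in> cyc a \<Longrightarrow> coprime t n"
  using coprime_n_g coprime_n_v n_pos unfolding cyc_def
  by (auto simp: coprime_commute[of g] coprime_commute[of v])

lemma N1_not_coprime: "t \<in> N1 \<Longrightarrow> \<not> coprime t n"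
  using gt_1 by (auto simp: N1_def n_def)

lemma N2_not_coprime: "t \<in> N2 \<Longrightarrow> \<not> coprime t n"
  using gt_1 by (auto simp: N2_def n_def)

lemma residues_partition:
  "{..<n} = insert 0 (N1 \<union> N2 \<union> units_mod n)"
proof (intro equalityI subsetI)
  fix t assume t: "t \<in> {..<n}"
  show "t \<in> insert 0 (N1 \<union> N2 \<union> units_mod n)"
  proof (cases "coprime t n")
    case False
    then have "n1 dvd t \<or> n2 dvd t"
      unfolding n_def by (metis coprime_commute coprime_mult_right_iff prime1 prime2 prime_imp_coprime)
    then show ?thesis
    proof
      assume "n1 dvd t"
      then obtain k where "t = k * n1" by (metis dvd_def mult.commute)
      with t have "t = 0 \<or> t \<in> N1" by (auto simp: N1_def n_def)
      then show ?thesis by blast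
    next
      assume "n2 dvd t"
      then obtain k where "t = k * n2" by (metis dvd_def mult.commute)
      with t have "t = 0 \<or> t \<in> N2" by (auto simp: N2_def n_def)
      then show ?thesis by blast
    qed
  qed (use t in \<open>auto simp: units_mod_def\<close>)
qed (use gt_1 in \<open>auto simp: N1_def N2_def n_def units_mod_def\<close>)

lemma N1_N2_disjoint: "N1 \<inter> N2 = {}"
proof -
  have False if t: "t \<in> N1" "t \<in> N2" for t
  proof -
    obtain k where k: "t = k * n1" "0 < k" "k < n2"
      using t(1) unfolding N1_def by force
    have "n2 dvd k * n1"
      using t(2) k(1) by (auto simp: N2_def)
    then have "n2 dvd k"
      using coprime12 by (metis coprime_commute coprime_dvd_mult_left_iff)
    with k show False
      by (auto dest: dvd_imp_le)
  qed
  then show ?thesis by auto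
qed

end

section \<open>Gauss periods\<close>

text \<open>Raise \<open>r ^ x\<close> to an inverse of \<open>x\<close> modulo
  \<open>y\<close>.\<close>

lemma power_eq_1_coprime:
  fixes r :: "'c::monoid_mult"
  assumes "r ^ x = 1" "r ^ y = 1" "coprime x y"
  shows "r = 1"
proof -
  obtain z where "[x * z = 1] (mod y)"
    using cong_solve_coprime_nat[OF assms(3)] by auto
  then have "r ^ (x * z) = r ^ 1"
    by (rule root_of_unity_power_cong[OF assms(2)])
  then show ?thesis
    by (simp add: power_mult assms(1))
qed

context whiteman
begin

lemma generator_power_cong:
  fixes r :: "'c::monoid_mult"
  assumes "r ^ n = 1" "[s + a = t + b] (mod (n1 - 1))" "[s = t] (mod (n2 - 1))"
  shows "r ^ (g ^ s * v ^ a) = r ^ (g ^ t * v ^ b)"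
  using assms generator_cong_iff by (intro root_of_unity_power_cong[OF assms(1)]) blast

lemma dvd_e: "n1 - 1 dvd e" "n2 - 1 dvd e"
  unfolding lcm_eq_e[symmetric] by simp_all

text \<open>\<open>e\<close> is a multiple of \<open>n1 - 1\<close> and of \<open>n2 - 1\<close>.
  This makes \<open>sum_periodic_shift\<close> applicable to sums over a whole class.\<close>

lemma power_periodic_e:
  fixes r :: "'c::monoid_mult"
  assumes "r ^ n = 1"
  shows "r ^ (g ^ (s + e) * v ^ a) = r ^ (g ^ s * v ^ a)"
proof (rule generator_power_cong[OF assms])
  have e: "[s + e = s] (mod (n1 - 1))" "[s + e = s] (mod (n2 - 1))"
    using dvd_e by (simp_all only: cong_add_lcancel_0_nat cong_0_iff)
  then show "[s + e = s] (mod (n2 - 1))" "[s + e + a = s + a] (mod (n1 - 1))"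
    by (simp_all only: cong_add_rcancel_nat)
qed

definition eta :: "nat \<Rightarrow> 'c::field \<Rightarrow> 'c" where
  "eta a r = (\<Sum>i\<in>cyc a. r ^ i)"

text \<open>The sum over \<open>N1\<close> is not replaced by -1, because \<open>W\<close> is also
  evaluated at \<open>r\<close> with \<open>r ^ n1 = 1\<close>, where that sum is
  \<open>n2 - 1\<close>.\<close>

definition W :: "nat \<Rightarrow> 'c::field \<Rightarrow> 'c" where
  "W a r = (\<Sum>i\<in>N1. r ^ i) + eta a r + eta (a + 1) r + eta (a + 2) r"

lemma eta_eq:
  assumes "r ^ n = 1"
  shows "eta a r = (\<Sum>s<e. r ^ (g ^ s * v ^ a))"
proof -
  have "eta a r = (\<Sum>s<e. r ^ (g ^ s * v ^ a mod n))"
    unfolding eta_def cyc_def by (simp add: sum.reindex inj_on_cyc)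
  also have "\<dots> = (\<Sum>s<e. r ^ (g ^ s * v ^ a))"
    by (intro sum.cong refl root_of_unity_power_cong[OF assms]) (simp add: cong_def)
  finally show ?thesis .
qed

text \<open>Exponents matter only modulo \<open>n2\<close>, where \<open>v\<close> is 1. So
  \<open>a\<close> drops out, and the powers of \<open>g\<close> fill \<open>(n1 - 1) div 6\<close>
  full periods.\<close>

lemma eta_root_n2:
  assumes "r ^ n2 = 1" "r \<noteq> 1"
  shows "eta a r = - of_nat ((n1 - 1) div 6)"
proof -
  have "r ^ n = 1"
    using assms(1) unfolding n_def by (simp add: power_mult mult.commute[of n1 n2])
  then have "eta a r = (\<Sum>s<e. r ^ (g ^ s * v ^ a))"
    by (rule eta_eq)
  also have "\<dots> = (\<Sum>s<e. r ^ (g ^ (s + 0)))"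
    using generator_cong2 by (intro sum.cong refl root_of_unity_power_cong[OF assms(1)]) simp
  also have "\<dots> = - of_nat ((n1 - 1) div 6)"
    unfolding e_blocks1 by (rule sum_primroot_powers[OF prime2 prim2 assms])
  finally show ?thesis .
qed

text \<open>Exponents matter only modulo \<open>n1\<close>, where \<open>v\<close> is
  \<open>g\<close>. So \<open>a\<close> merely moves the start of the range of exponents of
  \<open>g\<close>.\<close>

lemma eta_root_n1:
  assumes "r ^ n1 = 1" "r \<noteq> 1"
  shows "eta a r = - of_nat ((n2 - 1) div 6)"
proof -
  have "r ^ n = 1"
    using assms(1) unfolding n_def by (simp add: power_mult)
  then have "eta a r = (\<Sum>s<e. r ^ (g ^ s * v ^ a))"
    by (rule eta_eq)
  also have "\<dots> = (\<Sum>s<e. r ^ (g ^ (s + a)))"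
    using generator_cong1 by (intro sum.cong refl root_of_unity_power_cong[OF assms(1)]) simp
  also have "\<dots> = - of_nat ((n2 - 1) div 6)"
    unfolding e_blocks2 by (rule sum_primroot_powers[OF prime1 prim1 assms])
  finally show ?thesis .
qed

lemma sum_N1:
  fixes r :: "'c::field"
  shows "(\<Sum>i\<in>N1. r ^ i) = (\<Sum>k\<in>{0<..<n2}. (r ^ n1) ^ k)"
proof -
  have "inj_on (\<lambda>k. k * n1) {0<..<n2}"
    using gt_1 by (auto intro: inj_onI)
  then show ?thesis
    unfolding N1_def by (simp add: sum.reindex power_mult[symmetric] mult.commute)
qed

lemma sum_N1_nontrivial:
  fixes r :: "'c::field"
  assumes "r ^ n = 1" "r ^ n1 \<noteq> 1"
  shows "(\<Sum>i\<in>N1. r ^ i) = -1"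
  unfolding sum_N1 using assms gt_1
  by (intro sum_nontrivial_powers_root_of_unity) (simp_all add: power_mult[symmetric] n_def)

lemma sum_N2_nontrivial:
  fixes r :: "'c::field"
  assumes "r ^ n = 1" "r ^ n2 \<noteq> 1"
  shows "(\<Sum>i\<in>N2. r ^ i) = -1"
proof -
  have "inj_on (\<lambda>k. k * n2) {0<..<n1}"
    using gt_1 by (auto intro: inj_onI)
  then have "(\<Sum>i\<in>N2. r ^ i) = (\<Sum>k\<in>{0<..<n1}. (r ^ n2) ^ k)"
    unfolding N2_def by (simp add: sum.reindex power_mult[symmetric] mult.commute)
  also have "\<dots> = -1"
    using assms gt_1 by (intro sum_nontrivial_powers_root_of_unity)
      (simp_all add: power_mult[symmetric] n_def mult.commute)
  finally show ?thesis .
qed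

text \<open>Turns the truncated subtractions and integer divisions in the values of \<open>W\<close>
  into polynomial arithmetic in \<open>c\<close> and \<open>d\<close>.\<close>

lemma sixths:
  obtains c d where "n1 = 6 * c + 1" "n2 = 6 * d + 1" "e = 6 * c * d"
proof -
  obtain c d where cd: "n1 - 1 = 6 * c" "n2 - 1 = 6 * d"
    using six_dvd by (auto elim!: dvdE)
  moreover have "e = 6 * c * d"
    using six_e unfolding cd by simp
  ultimately show ?thesis
    using that[of c d] gt_1 by linarith
qed

section \<open>Values of \<open>W\<close> at 1 and at nontrivial roots of unity of prime
  order\<close>

lemma W_one: "W a (1 :: 'c::field) = of_nat ((n1 + 1) * (n2 - 1) div 2)"
proof -
  obtain c d where cd: "n1 = 6 * c + 1" "n2 = 6 * d + 1" "e = 6 * c * d"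
    by (rule sixths)
  have "W a (1 :: 'c) = of_nat (n2 - 1 + 3 * e)"
    unfolding W_def sum_N1 eta_def by (simp add: card_cyc)
  also have "n2 - 1 + 3 * e = (n1 + 1) * (n2 - 1) div 2"
    unfolding cd by (simp add: algebra_simps)
  finally show ?thesis .
qed

text \<open>By coprimality \<open>r ^ n1\<close> is not 1, so \<open>N1\<close> contributes -1; the
  three periods are equal.\<close>

lemma W_root_n2:
  fixes r :: "'c::field"
  assumes "r ^ n2 = 1" "r \<noteq> 1"
  shows "W a r = - of_nat ((n1 + 1) div 2)"
proof -
  obtain c d where cd: "n1 = 6 * c + 1" "n2 = 6 * d + 1" "e = 6 * c * d"
    by (rule sixths)
  have "r ^ n1 \<noteq> 1"
    using power_eq_1_coprime[OF _ assms(1) coprime12] assms(2) by blast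
  moreover have "r ^ n = 1"
    using assms(1) unfolding n_def by (simp add: power_mult mult.commute[of n1 n2])
  ultimately have "W a r = - of_nat (1 + 3 * ((n1 - 1) div 6))"
    unfolding W_def by (simp add: sum_N1_nontrivial eta_root_n2[OF assms])
  also have "1 + 3 * ((n1 - 1) div 6) = (n1 + 1) div 2"
    unfolding cd by simp
  finally show ?thesis .
qed

lemma W_root_n1:
  fixes r :: "'c::field"
  assumes "r ^ n1 = 1" "r \<noteq> 1"
  shows "W a r = of_nat ((n2 - 1) div 2)"
proof -
  obtain c d where cd: "n1 = 6 * c + 1" "n2 = 6 * d + 1" "e = 6 * c * d"
    by (rule sixths)
  have "W a r = of_nat (n2 - 1) - of_nat (3 * ((n2 - 1) div 6))"
    unfolding W_def sum_N1 eta_root_n1[OF assms] by (simp add: assms(1))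
  also have "\<dots> = of_nat ((n2 - 1) div 2)"
    unfolding cd by (simp add: algebra_simps)
  finally show ?thesis .
qed

text \<open>Multiplication by \<open>g ^ x * v ^ c\<close> sends class \<open>a\<close> to class
  \<open>a + c\<close>: the factor \<open>v ^ c\<close> adds to the index, and \<open>g ^ x\<close>
  only rotates the summation over \<open>s\<close>.\<close>

lemma eta_shift:
  assumes "b ^ n = 1" "t \<in> cyc c"
  shows "eta a (b ^ t) = eta (a + c) b"
proof -
  obtain x where x: "t = g ^ x * v ^ c mod n"
    using assms(2) unfolding cyc_def by blast
  have "b ^ t = b ^ (g ^ x * v ^ c)"
    by (rule root_of_unity_power_cong[OF assms(1)]) (simp add: x cong_def)
  moreover have "(b ^ t) ^ n = 1"
    using assms(1) by (metis power_mult mult.commute power_one)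
  ultimately have "eta a (b ^ t) = (\<Sum>s<e. (b ^ (g ^ x * v ^ c)) ^ (g ^ s * v ^ a))"
    by (simp only: eta_eq)
  also have "\<dots> = (\<Sum>s<e. b ^ (g ^ (s + x) * v ^ (a + c)))"
    unfolding power_mult[symmetric] power_add by (simp add: ac_simps)
  also have "\<dots> = (\<Sum>s<e. b ^ (g ^ s * v ^ (a + c)))"
    by (rule sum_periodic_shift) (rule power_periodic_e[OF assms(1)])
  also have "\<dots> = eta (a + c) b"
    using eta_eq[OF assms(1)] by simp
  finally show ?thesis .
qed

text \<open>\<open>v ^ 6\<close> is a power of \<open>g\<close> modulo \<open>n\<close>, so the six classes are permuted cyclically.\<close>

lemma eta_add_6:
  assumes "b ^ n = 1"
  shows "eta (a + 6) b = eta a b"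
proof -
  \<comment> \<open>The exponent \<open>(n2 - 1) * x\<close> is to be 6 modulo \<open>n1 - 1\<close>
    and 0 modulo \<open>n2 - 1\<close>, the discrete logarithms of \<open>v ^ 6\<close>. It exists
    because the gcd is 6.\<close>
  obtain x where "[(n2 - 1) * x = gcd (n2 - 1) (n1 - 1)] (mod (n1 - 1))"
    using cong_solve_nat[of "n2 - 1" "n1 - 1"] gt_1 by auto
  then have x: "[(n2 - 1) * x = 6] (mod (n1 - 1))"
    using gcd6 by (simp only: gcd.commute)
  have "b ^ (g ^ s * v ^ (a + 6)) = b ^ (g ^ (s + (n2 - 1) * x) * v ^ a)" for s
  proof (rule generator_power_cong[OF assms])
    have "[s + a + 6 = s + a + (n2 - 1) * x] (mod (n1 - 1))"
      using cong_sym[OF x] by (simp only: cong_add_lcancel_nat)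
    then show "[s + (a + 6) = s + (n2 - 1) * x + a] (mod (n1 - 1))"
      by (simp only: ac_simps)
    show "[s = s + (n2 - 1) * x] (mod (n2 - 1))"
      by (simp only: cong_def mod_mult_self2)
  qed
  then have "eta (a + 6) b = (\<Sum>s<e. b ^ (g ^ (s + (n2 - 1) * x) * v ^ a))"
    by (simp only: eta_eq[OF assms])
  also have "\<dots> = (\<Sum>s<e. b ^ (g ^ s * v ^ a))"
    by (rule sum_periodic_shift) (rule power_periodic_e[OF assms])
  finally show ?thesis
    by (simp only: eta_eq[OF assms])
qed

lemma N1_0_disjoint: "0 \<notin> N1" "0 \<notin> N2" "0 \<notin> units_mod n"
proof -
  have "n > 1"
    unfolding n_def using gt_1 by (rule less_1_mult)
  then show "0 \<notin> N1" "0 \<notin> N2" "0 \<notin> units_mod n"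
    using gt_1 by (auto simp: N1_def N2_def units_mod_def)
qed

lemma N_units_disjoint: "N1 \<inter> units_mod n = {}" "N2 \<inter> units_mod n = {}"
  using N1_not_coprime N2_not_coprime by (auto simp: units_mod_def)

lemma finite_N: "finite N1" "finite N2"
  by (auto simp: N1_def N2_def)

text \<open>The sum of all powers of \<open>b\<close> vanishes; the exponent 0 gives 1,
  \<open>N1\<close> and \<open>N2\<close> give -1 each, and the units give the six periods.\<close>

lemma sum_eta:
  assumes "b ^ n = 1" "b ^ n1 \<noteq> 1" "b ^ n2 \<noteq> 1"
  shows "eta 0 b + eta 1 b + eta 2 b + eta 3 b + eta 4 b + eta 5 b = 1"
proof -
  have "b \<noteq> 1" using assms(2) by auto
  then have "0 = (\<Sum>i<n. b ^ i)"
    using sum_powers_root_of_unity[OF assms(1)] by simp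
  also have "\<dots> = 1 + ((\<Sum>i\<in>N1. b ^ i) + (\<Sum>i\<in>N2. b ^ i) + (\<Sum>i\<in>units_mod n. b ^ i))"
    unfolding residues_partition
    using N1_0_disjoint N_units_disjoint N1_N2_disjoint
    by (simp add: sum.union_disjoint finite_N finite_units Int_Un_distrib2)
  also have "(\<Sum>i\<in>N1. b ^ i) = -1"
    by (rule sum_N1_nontrivial[OF assms(1,2)])
  also have "(\<Sum>i\<in>N2. b ^ i) = -1"
    by (rule sum_N2_nontrivial[OF assms(1,3)])
  also have "(\<Sum>i\<in>units_mod n. b ^ i) = (\<Sum>a<6. eta a b)"
    unfolding units_eq_UN_cyc eta_def using cyc_disjoint
    by (intro sum.UNION_disjoint) auto
  finally show ?thesis
    by (simp add: eval_nat_numeral algebra_simps eq_neg_iff_add_eq_0)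
qed

text \<open>The two triples of periods together make up all six, which sum to 1, while
  \<open>N1\<close> enters twice with -1. Only the indices 6 and 7 have to be wrapped
  around.\<close>

lemma W_opposite:
  assumes "b ^ n = 1" "b ^ n1 \<noteq> 1" "b ^ n2 \<noteq> 1" "a < 3"
  shows "W (a + 3) b = -1 - W a b"
proof -
  have "eta 6 b = eta 0 b" "eta 7 b = eta 1 b"
    using eta_add_6[OF assms(1), of 0] eta_add_6[OF assms(1), of 1] by simp_all
  then have "W (a + 3) b + W a b =
      -2 + (eta 0 b + eta 1 b + eta 2 b + eta 3 b + eta 4 b + eta 5 b)"
    using assms(4) by (auto simp: W_def sum_N1_nontrivial[OF assms(1,2)]
        numeral_eq_Suc less_Suc_eq)
  then show ?thesis
    unfolding sum_eta[OF assms(1-3)] by (simp add: eq_diff_eq)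
qed

text \<open>The periods move by \<open>eta_shift\<close>. The sum over \<open>N1\<close> stays -1:
  if \<open>(b ^ t) ^ n1\<close> were 1, then \<open>b ^ n1\<close> would be killed by the coprime
  exponents \<open>t\<close> and \<open>n\<close>.\<close>

lemma W_shift:
  assumes "b ^ n = 1" "b ^ n1 \<noteq> 1" "t \<in> cyc c"
  shows "W 0 (b ^ t) = W c b"
proof -
  have bt: "(b ^ t) ^ k = (b ^ k) ^ t" for k
    by (simp add: power_mult[symmetric] mult.commute)
  have "(b ^ t) ^ n1 \<noteq> 1"
  proof
    assume "(b ^ t) ^ n1 = 1"
    then have "(b ^ n1) ^ t = 1" "(b ^ n1) ^ n = 1"
      using assms(1) by (simp_all add: bt) (metis power_commutes power_mult mult.commute power_one)
    then show False
      using power_eq_1_coprime[of "b ^ n1" t n] cyc_coprime[OF assms(3)] assms(2) by blast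
  qed
  moreover have "(b ^ t) ^ n = 1"
    by (simp add: bt assms(1))
  ultimately show ?thesis
    unfolding W_def eta_shift[OF assms(1,3)]
    using assms(1,2) by (simp add: sum_N1_nontrivial add.commute)
qed

end

section \<open>Primitive elements of finite fields\<close>

text \<open>The powers of \<open>a\<close> repeat with period \<open>d\<close>, so they take at most
  \<open>d\<close> values, yet they reach every nonzero element.\<close>

lemma card_le_if_power_eq_1:
  fixes a :: "'b::{finite, field}"
  assumes "primitive_elem a" "a ^ d = 1" "d > 0"
  shows "CARD('b) - 1 \<le> d"
proof -
  have "UNIV - {0} \<subseteq> (\<lambda>k. a ^ k) ` {..<d}"
  proof
    fix x :: 'b
    assume "x \<in> UNIV - {0}"
    then obtain k where "a ^ k = x"
      using assms(1) by (auto simp: primitive_elem_def)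
    then have "x = a ^ (k mod d)"
      using root_of_unity_power_cong[OF assms(2), of k "k mod d"] by (simp add: cong_def)
    then show "x \<in> (\<lambda>k. a ^ k) ` {..<d}"
      using assms(3) by simp
  qed
  then have "card (UNIV - {0 :: 'b}) \<le> card ((\<lambda>k. a ^ k) ` {..<d})"
    by (intro card_mono) auto
  also have "\<dots> \<le> card {..<d}"
    by (rule card_image_le) simp
  finally show ?thesis
    by (simp add: card_Diff_singleton)
qed

text \<open>By pigeonhole two of the exponents \<open>0, ..., N\<close> give the same power. Their
  difference is at most \<open>N\<close>, and by the previous lemma at least
  \<open>N\<close>.\<close>

lemma primitive_elem_power_card:
  fixes a :: "'b::{finite, field}"
  assumes "primitive_elem a" "a \<noteq> 0"
  shows "a ^ (CARD('b) - 1) = 1"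
proof -
  define N where "N = CARD('b) - 1"
  have "\<not> inj_on (\<lambda>k. a ^ k) {..N}"
  proof
    assume "inj_on (\<lambda>k. a ^ k) {..N}"
    then have "card ((\<lambda>k. a ^ k) ` {..N}) = Suc N"
      by (simp add: card_image)
    moreover have "card ((\<lambda>k. a ^ k) ` {..N}) \<le> card (UNIV - {0 :: 'b})"
      using assms(2) by (intro card_mono) auto
    ultimately show False
      by (simp add: card_Diff_singleton N_def)
  qed
  then obtain i j where ij: "i < j" "j \<le> N" "a ^ i = a ^ j"
    unfolding inj_on_def by (metis atMost_iff linorder_neqE_nat)
  have "a ^ i * a ^ (j - i) = a ^ i * 1"
    unfolding power_add[symmetric] using ij by simp
  then have "a ^ (j - i) = 1"
    using assms(2) by simp
  moreover have "N \<le> j - i"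
    using card_le_if_power_eq_1[OF assms(1) calculation] ij(1) by (simp add: N_def)
  ultimately show ?thesis
    using ij by (metis N_def diff_le_self le_antisym le_trans)
qed

text \<open>A coincidence \<open>b ^ i = b ^ j\<close> with \<open>i < j < n\<close> would give
  \<open>a\<close> a positive exponent \<open>h * (j - i)\<close> below
  \<open>n * h = CARD('b) - 1\<close> with power 1.\<close>

lemma primitive_root_of_unity_from_primitive_elem:
  fixes a :: "'b::{finite, field}"
  assumes "primitive_elem a" "n dvd CARD('b) - 1" "n > 1"
  defines "b \<equiv> a ^ ((CARD('b) - 1) div n)"
  shows "b ^ n = 1" "inj_on (\<lambda>i. b ^ i) {..<n}"
proof -
  define N where "N = CARD('b) - 1"
  have "card {0, 1 :: 'b} \<le> CARD('b)"
    by (rule card_mono) auto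
  then have "N > 0"
    by (simp add: N_def)
  obtain h where h: "N = n * h"
    using assms(2) unfolding N_def[symmetric] by (auto elim: dvdE)
  with \<open>N > 0\<close> have "h > 0" by simp
  have b: "b = a ^ h"
    using h assms(3) unfolding b_def N_def[symmetric] by simp
  \<comment> \<open>\<open>primitive_elem 0\<close> does hold in the field with two elements.\<close>
  have a0: "a \<noteq> 0"
  proof
    assume "a = 0"
    then have "x \<in> {0, 1}" for x :: 'b
      using assms(1) unfolding primitive_elem_def
      by (metis insertCI power_0_left)
    then have "CARD('b) \<le> card {0, 1 :: 'b}"
      by (intro card_mono) auto
    then have "N \<le> 1"
      by (simp add: N_def)
    moreover have "n * 1 \<le> n * h"
      using \<open>h > 0\<close> by (intro mult_le_mono2) simp
    ultimately show False
      using assms(3) h by simp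
  qed
  show "b ^ n = 1"
    using primitive_elem_power_card[OF assms(1) a0] h
    unfolding b N_def[symmetric] by (simp add: power_mult[symmetric] mult.commute)
  show "inj_on (\<lambda>i. b ^ i) {..<n}"
  proof (rule linorder_inj_onI)
    fix i j
    assume ij: "i < j" "i \<in> {..<n}" "j \<in> {..<n}"
    show "b ^ i \<noteq> b ^ j"
    proof
      assume "b ^ i = b ^ j"
      then have "b ^ i * b ^ (j - i) = b ^ i * 1"
        unfolding power_add[symmetric] using ij by simp
      then have "a ^ (h * (j - i)) = 1"
        using a0 by (simp add: b power_mult)
      then have "n * h \<le> h * (j - i)"
        using card_le_if_power_eq_1[OF assms(1)] \<open>h > 0\<close> ij(1) unfolding N_def[symmetric] h by simp
      then show False
        using \<open>h > 0\<close> ij by (simp add: mult.commute[of n])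
    qed
  qed auto
qed

section \<open>Factors of \<open>x ^ n - 1\<close> and scalar extension\<close>

lemma root_prod_union:
  assumes "finite A" "finite B" "A \<inter> B = {}"
  shows "root_prod b (A \<union> B) = root_prod b A * root_prod b B"
  unfolding root_prod_def using assms by (rule prod.union_disjoint)

lemma root_prod_UN:
  assumes "finite K" "\<And>j. j \<in> K \<Longrightarrow> finite (A j)"
    and "\<And>i j. i \<in> K \<Longrightarrow> j \<in> K \<Longrightarrow> i \<noteq> j \<Longrightarrow> A i \<inter> A j = {}"
  shows "root_prod b (\<Union>j\<in>K. A j) = (\<Prod>j\<in>K. root_prod b (A j))"
  unfolding root_prod_def using assms by (intro prod.UNION_disjoint) auto

lemma root_prod_monic: "lead_coeff (root_prod (b :: 'b::idom) A) = 1"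
  unfolding root_prod_def by (simp add: lead_coeff_prod)

lemma root_prod_nonzero: "root_prod (b :: 'b::idom) A \<noteq> 0"
  using root_prod_monic[of b A] by auto

lemma degree_root_prod: "degree (root_prod (b :: 'b::idom) A) = card A"
  unfolding root_prod_def by (subst degree_prod_sum_eq) auto

lemma poly_root_prod_eq_0_iff:
  "finite A \<Longrightarrow> poly (root_prod (b :: 'b::idom) A) x = 0 \<longleftrightarrow> (\<exists>i\<in>A. x = b ^ i)"
  unfolding root_prod_def by (simp add: poly_prod)

text \<open>The roots are distinct, so the factors already split off do not vanish at the next root,
  and the remaining cofactor must.\<close>

lemma root_prod_dvd:
  fixes b :: "'b::field"
  assumes "finite A" "inj_on (\<lambda>i. b ^ i) A" "\<And>i. i \<in> A \<Longrightarrow> poly f (b ^ i) = 0"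
  shows "root_prod b A dvd f"
  using assms
proof (induction A)
  case (insert i A)
  then obtain h where h: "f = root_prod b A * h"
    by (auto elim: dvdE)
  have "poly (root_prod b A) (b ^ i) \<noteq> 0"
    using insert by (auto simp: poly_root_prod_eq_0_iff)
  then have "poly h (b ^ i) = 0"
    using insert.prems(2)[of i] by (simp add: h)
  then have "[:- (b ^ i), 1:] dvd h"
    by (simp add: poly_eq_0_iff_dvd)
  then have "root_prod b A * [:- (b ^ i), 1:] dvd f"
    unfolding h by (intro mult_dvd_mono dvd_refl)
  then show ?case
    using insert.hyps by (simp add: root_prod_def mult.commute)
qed (simp add: root_prod_def)

lemma monic_degree_0_eq_1: "degree c = 0 \<Longrightarrow> lead_coeff c = 1 \<Longrightarrow> c = 1"
  by (auto elim!: degree_eq_zeroE simp: one_pCons)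

lemma monic_dvd_same_degree:
  fixes f h :: "'b::field poly"
  assumes "f dvd h" "degree f = degree h" "lead_coeff f = 1" "lead_coeff h = 1"
  shows "f = h"
proof -
  obtain c where c: "h = f * c"
    using assms(1) by (auto elim: dvdE)
  with assms have "c \<noteq> 0" "f \<noteq> 0" by auto
  with c assms(2) have "degree c = 0"
    by (simp add: degree_mult_eq)
  moreover have "lead_coeff c = 1"
    using assms(3,4) unfolding c lead_coeff_mult by simp
  ultimately have "c = 1"
    by (rule monic_degree_0_eq_1)
  with c show ?thesis by simp
qed

lemma poly_xpow_minus1: "poly (xpow_minus1 k) x = x ^ k - 1"
  by (simp add: xpow_minus1_def poly_monom)

lemma xpow_minus1_monic:
  assumes "k > 0"
  shows "degree (xpow_minus1 k :: 'b::field poly) = k" "lead_coeff (xpow_minus1 k :: 'b poly) = 1"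
proof -
  have deg: "degree (1 :: 'b poly) < degree (Polynomial.monom (1 :: 'b) k)"
    using assms by (simp add: degree_monom_eq)
  show "degree (xpow_minus1 k :: 'b poly) = k"
    unfolding xpow_minus1_def diff_conv_add_uminus
    using degree_add_eq_left[of "- 1 :: 'b poly" "Polynomial.monom 1 k"] deg
    by (simp add: degree_monom_eq)
  then show "lead_coeff (xpow_minus1 k :: 'b poly) = 1"
    using assms by (simp add: xpow_minus1_def)
qed

text \<open>Every \<open>b ^ i\<close> is a root of the right-hand side, and both sides are monic of
  degree \<open>k\<close>.\<close>

lemma root_prod_roots_of_unity:
  fixes b :: "'b::field"
  assumes "b ^ k = 1" "inj_on (\<lambda>i. b ^ i) {..<k}" "k > 0"
  shows "root_prod b {..<k} = xpow_minus1 k"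
proof (rule monic_dvd_same_degree)
  have "poly (xpow_minus1 k) (b ^ i) = 0" for i
    using assms(1) by (simp add: poly_xpow_minus1)
      (metis power_mult mult.commute power_one)
  then show "root_prod b {..<k} dvd xpow_minus1 k"
    by (intro root_prod_dvd assms) auto
  show "degree (root_prod b {..<k}) = degree (xpow_minus1 k :: 'b poly)"
    by (simp add: degree_root_prod xpow_minus1_monic assms(3))
qed (fact root_prod_monic, fact xpow_minus1_monic(2)[OF assms(3)])

text \<open>Each \<open>b ^ i\<close> is a root of \<open>H\<close> or of \<open>Q\<close>. The
  linear factors at zeros of \<open>H\<close> divide \<open>H\<close> and the others divide
  \<open>Q\<close>; the leftover cofactors multiply to 1, and monicity of \<open>H\<close> makes
  them both 1.\<close>

lemma monic_factor_root_prod: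
  fixes H Q :: "'b::field poly"
  assumes "finite A" "inj_on (\<lambda>i. b ^ i) A" "Q * H = root_prod b A" "lead_coeff H = 1"
  shows "Q = root_prod b {i \<in> A. poly H (b ^ i) \<noteq> 0}"
proof -
  define Z where "Z = {i \<in> A. poly H (b ^ i) = 0}"
  define Y where "Y = {i \<in> A. poly H (b ^ i) \<noteq> 0}"
  have prod0: "poly Q (b ^ i) * poly H (b ^ i) = 0" if "i \<in> A" for i
    using that assms(1) unfolding poly_mult[symmetric] assms(3)
    by (auto simp: poly_root_prod_eq_0_iff)
  have "root_prod b Z dvd H" "root_prod b Y dvd Q"
    using assms(1,2) prod0 unfolding Y_def Z_def
    by (auto intro!: root_prod_dvd intro: inj_on_subset)
  then obtain c d where cd: "H = root_prod b Z * c" "Q = root_prod b Y * d"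
    by (auto elim!: dvdE)
  have "A = Y \<union> Z" "Y \<inter> Z = {}"
    by (auto simp: Y_def Z_def)
  then have "root_prod b A = root_prod b Y * root_prod b Z"
    using assms(1) by (simp add: root_prod_union)
  moreover have "root_prod b A = (root_prod b Y * root_prod b Z) * (c * d)"
    unfolding assms(3)[symmetric] cd by (simp only: ac_simps)
  ultimately have "(root_prod b Y * root_prod b Z) * (c * d) = (root_prod b Y * root_prod b Z) * 1"
    by simp
  then have "c * d = 1"
    by (simp add: root_prod_nonzero)
  then have "degree c = 0"
    by (metis dvd_triv_left is_unit_iff_degree one_neq_zero mult_zero_left)
  moreover have "lead_coeff c = 1"
    using assms(4) unfolding cd(1) by (simp add: lead_coeff_mult root_prod_monic)
  ultimately have "c = 1"
    by (rule monic_degree_0_eq_1)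
  with \<open>c * d = 1\<close> cd(2) show ?thesis
    by (simp add: Y_def)
qed

section \<open>Scalar extension of polynomials along a field embedding\<close>

locale field_embedding =
  fixes \<phi> :: "'a::field \<Rightarrow> 'b::field"
  assumes add: "\<And>x y. \<phi> (x + y) = \<phi> x + \<phi> y"
    and mult: "\<And>x y. \<phi> (x * y) = \<phi> x * \<phi> y"
    and one: "\<phi> 1 = 1"
begin

lemma zero: "\<phi> 0 = 0"
  using add[of 0 0] by (metis add_cancel_right_right)

lemma uminus: "\<phi> (- x) = - \<phi> x"
  using add[of x "- x"] by (simp add: zero eq_neg_iff_add_eq_0 add.commute)

lemma of_nat: "\<phi> (of_nat k) = of_nat k"
  by (induction k) (simp_all add: zero one add)

text \<open>The image of \<open>inverse x\<close> inverts the image of a nonzero \<open>x\<close>.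
  With \<open>of_nat\<close> this lets the vanishing of \<Omega>1, \<Omega>2 and \<Omega> be tested
  in the larger field.\<close>

lemma eq_0_iff: "\<phi> x = 0 \<longleftrightarrow> x = 0"
  using mult[of x "inverse x"] by (cases "x = 0") (auto simp: zero one)

lemma sum: "\<phi> (sum f A) = (\<Sum>i\<in>A. \<phi> (f i))"
  by (induction A rule: infinite_finite_induct) (simp_all add: zero add)

lemma map_poly_plus: "map_poly \<phi> (f + h) = map_poly \<phi> f + map_poly \<phi> h"
  by (rule poly_eqI) (simp add: coeff_map_poly zero add)

lemma map_poly_uminus: "map_poly \<phi> (- f) = - map_poly \<phi> f"
  by (rule poly_eqI) (simp add: coeff_map_poly zero uminus)

lemma map_poly_times: "map_poly \<phi> (f * h) = map_poly \<phi> f * map_poly \<phi> h"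
  by (rule poly_eqI) (simp add: coeff_map_poly zero coeff_mult sum mult)

lemma map_poly_sum: "map_poly \<phi> (sum f A) = (\<Sum>i\<in>A. map_poly \<phi> (f i))"
  by (induction A rule: infinite_finite_induct) (simp_all add: map_poly_plus)

lemma map_poly_xpow_minus1: "map_poly \<phi> (xpow_minus1 k) = xpow_minus1 k"
  unfolding xpow_minus1_def diff_conv_add_uminus map_poly_plus map_poly_uminus
  by (simp add: map_poly_monom zero one)

lemma poly_map_set_poly: "poly (map_poly \<phi> (set_poly A)) x = (\<Sum>i\<in>A. x ^ i)"
  unfolding set_poly_def map_poly_sum
  by (simp add: map_poly_monom zero one poly_sum poly_monom)

lemma lead_coeff_map_poly: "lead_coeff (map_poly \<phi> f) = \<phi> (lead_coeff f)"
  by (cases "f = 0") (auto simp: lead_coeff_map_poly_nz eq_0_iff zero)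

end

text \<open>
  The gcd is taken over the small field; by Bezout its roots among the powers of \<open>b\<close> are still
  the common roots, so the cofactor is determined after extending scalars.
\<close>

lemma map_poly_cofactor_gcd:
  fixes \<phi> :: "'a::field_gcd \<Rightarrow> 'b::field" and f :: "'a poly"
  assumes "field_embedding \<phi>" and b: "b ^ n = 1" "inj_on (\<lambda>i. b ^ i) {..<n}" "n > 0"
  shows "map_poly \<phi> (xpow_minus1 n div gcd (xpow_minus1 n) f) =
    root_prod b {i \<in> {..<n}. poly (map_poly \<phi> f) (b ^ i) \<noteq> 0}"
proof -
  interpret field_embedding \<phi> by fact
  define G where "G = gcd (xpow_minus1 n) f"
  have nz: "(xpow_minus1 n :: 'a poly) \<noteq> 0"
    using xpow_minus1_monic[where 'b = 'a, OF b(3)] by auto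
  then have "G \<noteq> 0" by (simp add: G_def)
  \<comment> \<open>A gcd is normalised, so its unit factor is 1; over a field the unit factor of a
    nonzero constant is the constant itself.\<close>
  have "lead_coeff G = 1"
  proof -
    have "unit_factor G = 1"
      unfolding G_def unit_factor_gcd using nz by simp
    then have "unit_factor (lead_coeff G) = 1"
      by (simp add: unit_factor_poly_def one_pCons)
    moreover have "unit_factor (lead_coeff G) = lead_coeff G"
      using \<open>G \<noteq> 0\<close> by (intro is_unit_unit_factor) (simp add: dvd_field_iff)
    ultimately show ?thesis by simp
  qed
  then have lc: "lead_coeff (map_poly \<phi> G) = 1"
    by (simp add: lead_coeff_map_poly one)
  have "map_poly \<phi> (xpow_minus1 n div G) * map_poly \<phi> G = map_poly \<phi> (xpow_minus1 n)"
    unfolding map_poly_times[symmetric] by (simp add: G_def)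
  also have "\<dots> = root_prod b {..<n}"
    by (simp add: map_poly_xpow_minus1 root_prod_roots_of_unity b)
  finally have cofactor: "map_poly \<phi> (xpow_minus1 n div G) =
      root_prod b {i \<in> {..<n}. poly (map_poly \<phi> G) (b ^ i) \<noteq> 0}"
    by (intro monic_factor_root_prod lc b) auto
  have "poly (map_poly \<phi> G) (b ^ i) = 0 \<longleftrightarrow> poly (map_poly \<phi> f) (b ^ i) = 0" for i
  proof
    assume "poly (map_poly \<phi> G) (b ^ i) = 0"
    moreover obtain h where "f = G * h"
      unfolding G_def by (meson gcd_dvd2 dvdE)
    ultimately show "poly (map_poly \<phi> f) (b ^ i) = 0"
      by (simp add: map_poly_times)
  next
    assume f0: "poly (map_poly \<phi> f) (b ^ i) = 0"
    obtain x y where "G = x * xpow_minus1 n + y * f"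
      using bezout_coefficients_fst_snd[of "xpow_minus1 n" f] G_def by metis
    moreover have "(b ^ i) ^ n = 1"
      using b(1) by (metis power_mult mult.commute power_one)
    ultimately show "poly (map_poly \<phi> G) (b ^ i) = 0"
      using f0 by (simp add: map_poly_plus map_poly_times map_poly_xpow_minus1 poly_xpow_minus1)
  qed
  with cofactor show ?thesis
    by (simp add: G_def)
qed

text \<open>The powers \<open>b ^ (k * c)\<close> are those of \<open>b ^ c\<close>, whose first
  \<open>d\<close> powers are distinct.\<close>

lemma root_prod_multiples:
  fixes b :: "'b::field"
  assumes "b ^ (c * d) = 1" "inj_on (\<lambda>i. b ^ i) {..<c * d}" "c > 0" "d > 0"
  shows "root_prod b ((\<lambda>k. k * c) ` {..<d}) = xpow_minus1 d"
proof -
  have inj: "inj_on (\<lambda>k. k * c) {..<d}"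
    using assms(3) by (auto intro: inj_onI)
  have "root_prod b ((\<lambda>k. k * c) ` {..<d}) = root_prod (b ^ c) {..<d}"
    unfolding root_prod_def prod.reindex[OF inj]
    by (simp add: power_mult[symmetric] mult.commute[of c])
  also have "\<dots> = xpow_minus1 d"
  proof (rule root_prod_roots_of_unity)
    show "inj_on (\<lambda>i. (b ^ c) ^ i) {..<d}"
    proof (rule inj_onI)
      fix i j assume "i \<in> {..<d}" "j \<in> {..<d}" "(b ^ c) ^ i = (b ^ c) ^ j"
      then have "c * i = c * j"
        using assms(3) by (intro inj_onD[OF assms(2)]) (auto simp: power_mult)
      then show "i = j"
        using assms(3) by simp
    qed
  qed (use assms in \<open>simp_all add: power_mult\<close>)
  finally show ?thesis .
qed

text \<open>Common form of all five cases: \<open>B\<close> holds the exponents where S does not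
  vanish, \<open>Y\<close> the nonunits among the zeros to be divided out, \<open>Z\<close> the
  units among them.\<close>

lemma root_prod_eq_div:
  fixes b :: "'b::field"
  assumes "finite U" "U = B \<union> (Y \<union> Z)" "B \<inter> (Y \<union> Z) = {}" "Y \<inter> Z = {}"
  shows "root_prod b B = root_prod b U div (root_prod b Y * root_prod b Z)"
proof -
  have "root_prod b U = root_prod b B * (root_prod b Y * root_prod b Z)"
    using assms by (simp add: root_prod_union)
  then show ?thesis
    by (simp add: root_prod_nonzero)
qed

section \<open>The generator polynomial\<close>

text \<open>The bound keeps \<open>a + 2\<close> below 6, where the classes are known to be
  disjoint; 0, 1 and 2 give S, T and M.\<close>

lemma (in whiteman) sum_N1_cyc:
  fixes r :: "'c::field"
  assumes "a < 4"
  shows "(\<Sum>i\<in>N1 \<union> cyc a \<union> cyc (a + 1) \<union> cyc (a + 2). r ^ i) = W a r"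
proof -
  have "N1 \<inter> cyc c = {}" for c
    using N1_not_coprime cyc_coprime by blast
  moreover have "cyc a \<inter> cyc (a + 1) = {}" "cyc a \<inter> cyc (a + 2) = {}"
    "cyc (a + 1) \<inter> cyc (a + 2) = {}"
    using assms by (intro cyc_disjoint; simp)+
  ultimately show ?thesis
    unfolding W_def eta_def by (simp add: sum.union_disjoint finite_N Int_Un_distrib2)
qed

text \<open>The identities live over \<open>'b\<close>, which contains \<beta>; \<phi> carries the
  generator polynomial there. The divisions turn out to be exact, by
  \<open>root_prod_eq_div\<close>.\<close>

theorem theorem2:
  fixes n1 n2 n e g p k m :: nat
    and u :: int
    and \<phi> :: "'a::{finite, field_gcd} \<Rightarrow> 'b::{finite, field}"
    and \<alpha> \<beta> Sb Tb Mb :: 'b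
    and S T M gs :: "'a poly"
    and P :: "'b poly"
    and K :: "nat set"
    and \<Omega>1 \<Omega>2 \<Omega> :: 'a
  assumes n1_prime: "prime n1" and n2_prime: "prime n2"
    and n1_odd: "odd n1" and n2_odd: "odd n2" and neq: "n1 \<noteq> n2"
    and gcd6: "gcd (n1 - 1) (n2 - 1) = 6"
    and n_def: "n = n1 * n2"
    and e_def: "e = (n1 - 1) * (n2 - 1) div 6"
    and g_prim1: "residue_primroot n1 g" and g_prim2: "residue_primroot n2 g"
    and u1: "[u = int g] (mod int n1)" and u2: "[u = 1] (mod int n2)"
    and p_prime: "prime p" and k_pos: "k > 0"
    and card_a: "CARD('a) = p ^ k"
    and q_coprime: "coprime (p ^ k) n"
    and q_in: "(p ^ k) mod n \<in> whiteman_class n e g u 0 \<union> whiteman_class n e g u 2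
                                 \<union> whiteman_class n e g u 4"
    and m_def: "m = ord n (p ^ k)"
    and card_b: "CARD('b) = (p ^ k) ^ m"
    and phi_add: "\<And>x y. \<phi> (x + y) = \<phi> x + \<phi> y"
    and phi_mult: "\<And>x y. \<phi> (x * y) = \<phi> x * \<phi> y"
    and phi_one: "\<phi> 1 = 1"
    and phi_inj: "inj \<phi>"
    and alpha_prim: "primitive_elem \<alpha>"
    and beta_def: "\<beta> = \<alpha> ^ (((p ^ k) ^ m - 1) div n)"
  assumes "S = (set_poly (N1_set n1 n2 \<union> whiteman_class n e g u 0 \<union> whiteman_class n e g u 1 \<union> whiteman_class n e g u 2) :: 'a poly)"
    and "T = (set_poly (N1_set n1 n2 \<union> whiteman_class n e g u 1 \<union> whiteman_class n e g u 2 \<union> whiteman_class n e g u 3) :: 'a poly)"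
    and "M = (set_poly (N1_set n1 n2 \<union> whiteman_class n e g u 2 \<union> whiteman_class n e g u 3 \<union> whiteman_class n e g u 4) :: 'a poly)"
    and "gs = xpow_minus1 n div gcd (xpow_minus1 n) S"
    and "Sb = poly (map_poly \<phi> S) \<beta>"
    and "Tb = poly (map_poly \<phi> T) \<beta>"
    and "Mb = poly (map_poly \<phi> M) \<beta>"
    and "K = (if Sb = 0 then {0} else {}) \<union> (if Sb = -1 then {3} else {})
            \<union> (if Tb = 0 then {1} else {}) \<union> (if Tb = -1 then {4} else {})
            \<union> (if Mb = 0 then {2} else {}) \<union> (if Mb = -1 then {5::nat} else {})"
    and "P = (\<Prod>j\<in>K. root_prod \<beta> (whiteman_class n e g u j))"
    and "\<Omega>1 = (of_nat ((n1 + 1) div 2) :: 'a)"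
    and "\<Omega>2 = (of_nat ((n2 - 1) div 2) :: 'a)"
    and "\<Omega> = (of_nat ((n1 + 1) * (n2 - 1) div 2) :: 'a)"
  assumes K_nonempty: "K \<noteq> {}"
  shows "(\<Omega>1 \<noteq> 0 \<and> \<Omega>2 \<noteq> 0 \<and> \<Omega> \<noteq> 0 \<longrightarrow>
            map_poly \<phi> gs = xpow_minus1 n div P)
       \<and> (\<Omega>1 \<noteq> 0 \<and> \<Omega>2 \<noteq> 0 \<and> \<Omega> = 0 \<longrightarrow>
            map_poly \<phi> gs = xpow_minus1 n div ([:-1, 1:] * P))
       \<and> (\<Omega>1 = 0 \<and> \<Omega>2 \<noteq> 0 \<and> \<Omega> = 0 \<longrightarrow>
            map_poly \<phi> gs = xpow_minus1 n div (xpow_minus1 n2 * P))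
       \<and> (\<Omega>1 \<noteq> 0 \<and> \<Omega>2 = 0 \<and> \<Omega> = 0 \<longrightarrow>
            map_poly \<phi> gs = xpow_minus1 n div (xpow_minus1 n1 * P))
       \<and> (\<Omega>1 = 0 \<and> \<Omega>2 = 0 \<and> \<Omega> = 0 \<longrightarrow>
            map_poly \<phi> gs = root_prod \<beta> (units_mod n) div P)"
proof -
  note sets_def = assms(26-28) and gs_def = assms(29) and values_def = assms(30-32)
    and K_def = assms(33) and P_def = assms(34) and Omega_def = assms(35-37)
  \<comment> \<open>\<open>u\<close> may be negative; its residue modulo \<open>n\<close> is the
    natural number that the locale needs.\<close>
  define v where "v = nat (u mod int n)"
  have n1: "n1 > 1" and n2: "n2 > 1"
    using prime_gt_1_nat[OF n1_prime] prime_gt_1_nat[OF n2_prime] .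
  then have n: "n > 1"
    unfolding n_def by (rule less_1_mult)
  have int_v: "int v = u mod int n"
    using n by (simp add: v_def)
  have "[int v = u] (mod int n)"
    by (simp add: int_v cong_def)
  then have vu: "[int v = u] (mod int n1)" "[int v = u] (mod int n2)"
    by (rule cong_dvd_modulus; simp add: n_def)+
  interpret whiteman n1 n2 n e g v
  proof
    show "[v = g] (mod n1)"
      using cong_trans[OF vu(1) u1] by (simp add: cong_int_iff)
    show "[v = 1] (mod n2)"
      using cong_trans[OF vu(2) u2] by (simp flip: cong_int_iff)
  qed (fact assms)+
  have cls: "whiteman_class n e g u i = cyc i" for i
  proof -
    have "nat (int g ^ s * u ^ i mod int n) = g ^ s * v ^ i mod n" for s
    proof -
      have "int (g ^ s * v ^ i mod n) = int g ^ s * (u mod int n) ^ i mod int n"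
        by (simp add: zmod_int int_v)
      also have "\<dots> = int g ^ s * u ^ i mod int n"
        by (metis mod_mult_right_eq power_mod)
      finally show ?thesis
        by (metis nat_int)
    qed
    then show ?thesis
      unfolding whiteman_class_def cyc_def by auto
  qed
  have N1: "N1_set n1 n2 = N1"
  proof -
    have "1 \<le> j \<and> j \<le> n2 - 1 \<longleftrightarrow> j \<in> {0<..<n2}" for j
      using n2 by auto
    then show ?thesis
      unfolding N1_set_def N1_def by blast
  qed
  interpret field_embedding \<phi>
    by standard (fact phi_add phi_mult phi_one)+

  have "[(p ^ k) ^ m = 1] (mod n)"
    unfolding m_def using ord_works by blast
  then have "n dvd CARD('b) - 1"
    unfolding card_b by (rule cong_to_1_nat)
  from primitive_root_of_unity_from_primitive_elem[OF alpha_prim this n]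
  have b: "\<beta> ^ n = 1" "inj_on (\<lambda>i. \<beta> ^ i) {..<n}"
    unfolding beta_def card_b by simp_all
  have prim: "\<beta> ^ t \<noteq> 1" if "0 < t" "t < n" for t
    using inj_onD[OF b(2), of t 0] that by auto
  have b1: "\<beta> ^ n1 \<noteq> 1" and b2: "\<beta> ^ n2 \<noteq> 1"
    using prim[of n1] prim[of n2] n1 n2 by (simp_all add: n_def)

  have value_S: "poly (map_poly \<phi> S) x = W 0 x" for x
    using sum_N1_cyc[of 0 x] by (simp add: sets_def poly_map_set_poly cls N1 numeral_2_eq_2)
  have Sb: "Sb = W 0 \<beta>" and Tb: "Tb = W 1 \<beta>" and Mb: "Mb = W 2 \<beta>"
    using sum_N1_cyc[of 0 \<beta>] sum_N1_cyc[of 1 \<beta>] sum_N1_cyc[of 2 \<beta>]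
    by (simp_all add: sets_def values_def poly_map_set_poly cls N1 numeral_eq_Suc)
  have "W 3 \<beta> = -1 - W 0 \<beta>" "W 4 \<beta> = -1 - W 1 \<beta>" "W 5 \<beta> = -1 - W 2 \<beta>"
    using W_opposite[OF b(1) b1 b2, of 0] W_opposite[OF b(1) b1 b2, of 1]
      W_opposite[OF b(1) b1 b2, of 2] by simp_all
  then have opp: "Sb = -1 \<longleftrightarrow> W 3 \<beta> = 0" "Tb = -1 \<longleftrightarrow> W 4 \<beta> = 0" "Mb = -1 \<longleftrightarrow> W 5 \<beta> = 0"
    unfolding Sb Tb Mb by auto
  have K: "j \<in> K \<longleftrightarrow> j < 6 \<and> W j \<beta> = 0" for j
  proof -
    have "j < 6 \<longleftrightarrow> j = 0 \<or> j = 1 \<or> j = 2 \<or> j = 3 \<or> j = 4 \<or> j = 5"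
      by auto
    then show ?thesis
      unfolding K_def opp unfolding Sb Tb Mb by auto
  qed

  \<comment> \<open>\<open>B\<close> indexes the roots of the generator polynomial; \<open>Z\<close>
    will be shown to be the unit exponents at which S vanishes.\<close>
  define B where "B = {i \<in> {..<n}. W 0 (\<beta> ^ i) \<noteq> 0}"
  define Z where "Z = (\<Union>j\<in>K. cyc j)"
  have gs: "map_poly \<phi> gs = root_prod \<beta> B"
    unfolding gs_def B_def value_S[symmetric]
    using n by (intro map_poly_cofactor_gcd b field_embedding_axioms) simp
  have fin_K: "finite K"
    by (rule finite_subset[of _ "{..<6}"]) (auto simp: K)
  have P: "P = root_prod \<beta> Z"
    unfolding P_def Z_def cls using fin_K
    by (intro root_prod_UN[symmetric] cyc_disjoint) (auto simp: K)

  have zero_0: "W 0 (\<beta> ^ 0) = 0 \<longleftrightarrow> \<Omega> = 0"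
    unfolding Omega_def power_0 W_one by (metis eq_0_iff of_nat)
  \<comment> \<open>The primes cross over: a nonzero multiple of \<open>n1\<close> as exponent
    yields a nontrivial \<open>n2\<close>-th root of unity. Hence \<Omega>1 decides about the factor
    \<open>xpow_minus1 n2\<close> below.\<close>
  have zero_N1: "W 0 (\<beta> ^ t) = 0 \<longleftrightarrow> \<Omega>1 = 0" if t: "t \<in> N1" for t
  proof -
    obtain j where j: "t = j * n1" "0 < j" "j < n2"
      using t unfolding N1_def by force
    have "(\<beta> ^ t) ^ n2 = (\<beta> ^ n) ^ j"
      unfolding power_mult[symmetric] by (simp add: j n_def ac_simps)
    moreover have "\<beta> ^ t \<noteq> 1"
      using j n1 by (intro prim) (simp_all add: n_def mult.commute[of n1])
    ultimately have "W 0 (\<beta> ^ t) = - of_nat ((n1 + 1) div 2)"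
      by (intro W_root_n2) (simp_all add: b(1))
    then show ?thesis
      unfolding Omega_def by (metis eq_0_iff of_nat neg_equal_0_iff_equal)
  qed
  have zero_N2: "W 0 (\<beta> ^ t) = 0 \<longleftrightarrow> \<Omega>2 = 0" if t: "t \<in> N2" for t
  proof -
    obtain j where j: "t = j * n2" "0 < j" "j < n1"
      using t unfolding N2_def by force
    have "(\<beta> ^ t) ^ n1 = (\<beta> ^ n) ^ j"
      unfolding power_mult[symmetric] by (simp add: j n_def ac_simps)
    moreover have "\<beta> ^ t \<noteq> 1"
      using j n2 by (intro prim) (simp_all add: n_def)
    ultimately have "W 0 (\<beta> ^ t) = of_nat ((n2 - 1) div 2)"
      by (intro W_root_n1) (simp_all add: b(1))
    then show ?thesis
      unfolding Omega_def by (metis eq_0_iff of_nat)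
  qed
  have Z_units: "Z \<subseteq> units_mod n"
    unfolding Z_def units_eq_UN_cyc by (auto simp: K)
  have zero_units: "W 0 (\<beta> ^ t) = 0 \<longleftrightarrow> t \<in> Z" if t: "t \<in> units_mod n" for t
  proof -
    obtain c where c: "c < 6" "t \<in> cyc c"
      using t unfolding units_eq_UN_cyc by auto
    \<comment> \<open>As the class of \<open>t\<close> is unique, membership of \<open>t\<close> in
      \<open>Z\<close> depends only on whether \<open>c\<close> lies in \<open>K\<close>.\<close>
    have "d = c" if "d < 6" "t \<in> cyc d" for d
      using that c cyc_disjoint[of c d] by blast
    then have "t \<in> Z \<longleftrightarrow> c \<in> K"
      unfolding Z_def UN_iff using c(2) K by blast
    then show ?thesis
      using c(1) unfolding W_shift[OF b(1) b1 c(2)] K by simp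
  qed

  note disjoint = N1_0_disjoint N_units_disjoint N1_N2_disjoint
  have B: "B = {t. t = 0 \<and> \<Omega> \<noteq> 0} \<union> {t \<in> N1. \<Omega>1 \<noteq> 0} \<union> {t \<in> N2. \<Omega>2 \<noteq> 0} \<union> (units_mod n - Z)"
    unfolding B_def residues_partition using zero_0 zero_N1 zero_N2 zero_units by blast
  have full: "root_prod \<beta> {..<n} = xpow_minus1 n"
    using n by (intro root_prod_roots_of_unity b) simp
  have "(\<lambda>k. k * n1) ` {..<n2} = insert 0 N1"
  proof -
    have "{..<n2} = insert 0 {0<..<n2}" using n2 by auto
    then show ?thesis by (simp add: N1_def)
  qed
  then have prod_N1: "root_prod \<beta> (insert 0 N1) = xpow_minus1 n2"
    using root_prod_multiples[of \<beta> n1 n2] b n1 n2 by (simp add: n_def)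
  have "(\<lambda>k. k * n2) ` {..<n1} = insert 0 N2"
  proof -
    have "{..<n1} = insert 0 {0<..<n1}" using n1 by auto
    then show ?thesis by (simp add: N2_def)
  qed
  then have prod_N2: "root_prod \<beta> (insert 0 N2) = xpow_minus1 n1"
    using root_prod_multiples[of \<beta> n2 n1] b n1 n2 by (simp add: n_def mult.commute[of n1])
  have prod_0: "root_prod \<beta> {0} = [:-1, 1:]" and prod_empty: "root_prod \<beta> {} = 1"
    by (simp_all add: root_prod_def)

  have cofactor: "map_poly \<phi> gs = xpow_minus1 n div (root_prod \<beta> Y * P)"
    if "{..<n} = B \<union> (Y \<union> Z)" "B \<inter> (Y \<union> Z) = {}" "Y \<inter> Z = {}" for Y
    unfolding gs P full[symmetric] by (rule root_prod_eq_div[OF finite_lessThan that])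
  show ?thesis
  proof (intro conjI impI)
    assume "\<Omega>1 \<noteq> 0 \<and> \<Omega>2 \<noteq> 0 \<and> \<Omega> \<noteq> 0"
    then have "map_poly \<phi> gs = xpow_minus1 n div (root_prod \<beta> {} * P)"
      using Z_units disjoint by (intro cofactor) (auto simp: B residues_partition)
    then show "map_poly \<phi> gs = xpow_minus1 n div P"
      by (simp add: prod_empty)
  next
    assume "\<Omega>1 \<noteq> 0 \<and> \<Omega>2 \<noteq> 0 \<and> \<Omega> = 0"
    then show "map_poly \<phi> gs = xpow_minus1 n div ([:-1, 1:] * P)"
      using Z_units disjoint unfolding prod_0[symmetric]
      by (intro cofactor) (auto simp: B residues_partition)
  next
    assume "\<Omega>1 = 0 \<and> \<Omega>2 \<noteq> 0 \<and> \<Omega> = 0"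
    then show "map_poly \<phi> gs = xpow_minus1 n div (xpow_minus1 n2 * P)"
      using Z_units disjoint unfolding prod_N1[symmetric]
      by (intro cofactor) (auto simp: B residues_partition)
  next
    assume "\<Omega>1 \<noteq> 0 \<and> \<Omega>2 = 0 \<and> \<Omega> = 0"
    then show "map_poly \<phi> gs = xpow_minus1 n div (xpow_minus1 n1 * P)"
      using Z_units disjoint unfolding prod_N2[symmetric]
      by (intro cofactor) (auto simp: B residues_partition)
  next
    assume "\<Omega>1 = 0 \<and> \<Omega>2 = 0 \<and> \<Omega> = 0"
    then have "units_mod n = B \<union> ({} \<union> Z)" "B \<inter> ({} \<union> Z) = {}"
      using Z_units unfolding B by auto
    from root_prod_eq_div[OF finite_units this, of \<beta>]
    show "map_poly \<phi> gs = root_prod \<beta> (units_mod n) div P"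
      by (simp add: gs P prod_empty)
  qed
qed

end
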